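(* Let $B_0$ be a skew-symmetrizable integer $n\times n$ matrix, taken as initial exchange matrix, and assume that the sign coherence property holds for $B_0$: in every $Y$-seed $(\mathbf c,B)$ with respect to the initial $Y$-seed $(\mathbf c_0,B_0)$, each vector $\mathbf c_j$ has either all entries non-negative or all entries non-positive. Suppose that there is a vector $u>0$ (that is, $u\in\mathbb R^n$ is non-zero with all entries non-negative) such that, for every $Y$-seed $(\mathbf c,B)$ with respect to the initial $Y$-seed $(\mathbf c_0,B_0)$, the coordinates of $u$ with respect to the basis $\mathbf c$ are non-negative. Then $B_0$ does not have any maximal green sequences.
   Context: An integer $n\times n$ matrix $B$ is skew-symmetrizable if there is a diagonal matrix $D$ with positive diagonal entries such that $DB$ is skew-symmetric. Notation: $[b]_+=\max(b,0)$. For $k\in\{1,\dots,n\}$, the matrix mutation $\mu_k(B)=B'$ is given by $B'_{ij}=-B_{ij}$ if $i=k$ or $j=k$, and $B'_{ij}=B_{ij}+[B_{ik}]_+[B_{kj}]_+-[-B_{ik}]_+[-B_{kj}]_+$ otherwise. A $Y$-seed is a pair $(\mathbf c,B)$ with $B$ a skew-symmetrizable integer $n\times n$ matrix and $\mathbf c=(\mathbf c_1,\dots,\mathbf c_n)$ a tuple of non-zero vectors in $\mathbb Z^n$. Write $\mathbf c_j>0$ (resp. $\mathbf c_j<0$) if all entries of the non-zero vector $\mathbf c_j$ are non-negative (resp. non-positive), and $\operatorname{sgn}(\mathbf c_j)=1$ (resp. $-1$) accordingly. If $\mathbf c_k>0$ or $\mathbf c_k<0$, the $Y$-seed mutation $\mu_k(\mathbf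 c,B)=(\mathbf c',B')$ is defined by $B'=\mu_k(B)$, $\mathbf c'_k=-\mathbf c_k$, and $\mathbf c'_i=\mathbf c_i+[\operatorname{sgn}(\mathbf c_k)B_{k,i}]_+\mathbf c_k$ for $i\ne k$. The initial $Y$-seed is $(\mathbf c_0,B_0)$, where $\mathbf c_0$ is the tuple of standard basis vectors of $\mathbb Z^n$. A $Y$-seed with respect to the initial $Y$-seed $(\mathbf c_0,B_0)$ is one obtained from $(\mathbf c_0,B_0)$ by a finite (possibly empty) sequence of $Y$-seed mutations. Under the sign coherence property, all mutations are defined, and in each such $Y$-seed $\mathbf c$ is a basis of $\mathbb Z^n$; the coordinates of $u$ with respect to $\mathbf c$ are the numbers $a_i$ with $u=\sum_i a_i\mathbf c_i$. A green sequence for $B_0$ is a sequence $(i_1,\dots,i_l)$ of indices such that for every $1\le k\le l$, writing $(\mathbf c,B)=\mu_{i_{k-1}}\circ\cdots\circ\mu_{i_1}(\mathbf c_0,B_0)$ (with $(\mathbf c,B)=(\mathbf c_0,B_0)$ if $k=1$), one has $\mathbf c_{i_k}>0$. It is maximal if for $(\mathbf c,B)=\mu_{i_l}\circ\cdots\circ\mu_{i_1}(\mathbf c_0,B_0)$ one has $\mathbf c_k<0$ for all $k=1,\dots,n$. *)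

theory Defs
  imports "HOL-Analysis.Analysis"
begin

text \<open>Vectors carry the componentwise partial order of the library, so \<open>0 < v\<close> says that
  \<open>v\<close> is non-zero with all entries non-negative, and \<open>v < 0\<close> that it is non-zero with all
  entries non-positive.\<close>

definition real_vec :: "int ^ 'n \<Rightarrow> real ^ 'n" where
  "real_vec v = (\<chi> i. real_of_int (v $ i))"

definition real_mat :: "int ^ 'n ^ 'm \<Rightarrow> real ^ 'n ^ 'm" where
  "real_mat B = (\<chi> i j. real_of_int (B $ i $ j))"

definition skew_symmetrizable :: "int ^ 'n ^ 'n \<Rightarrow> bool" where
  "skew_symmetrizable B \<longleftrightarrow>
    (\<exists>D :: real ^ 'n ^ 'n. (\<forall>i j. i \<noteq> j \<longrightarrow> D $ i $ j = 0) \<and> (\<forall>i. 0 < D $ i $ i) \<and>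
       transpose (D ** real_mat B) = - (D ** real_mat B))"

definition pos_part :: "int \<Rightarrow> int" where
  "pos_part b = max b 0"

definition matrix_mutation :: "'n \<Rightarrow> int ^ 'n ^ 'n \<Rightarrow> int ^ 'n ^ 'n" where
  "matrix_mutation k B = (\<chi> i j.
     if i = k \<or> j = k then - B $ i $ j
     else B $ i $ j + pos_part (B $ i $ k) * pos_part (B $ k $ j)
            - pos_part (- B $ i $ k) * pos_part (- B $ k $ j))"

type_synonym 'n seed = "('n \<Rightarrow> int ^ 'n) \<times> (int ^ 'n ^ 'n)"

definition Y_seed :: "'n::finite seed \<Rightarrow> bool" where
  "Y_seed = (\<lambda>(c, B). skew_symmetrizable B \<and> (\<forall>j. c j \<noteq> 0))"

text \<open>The value \<open>0\<close> is a dummy for vectors without a well-defined sign.\<close>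

definition vec_sgn :: "int ^ 'n \<Rightarrow> int" where
  "vec_sgn v = (if 0 < v then 1 else if v < 0 then -1 else 0)"

text \<open>This is a total function; it is meaningful only if \<open>c k\<close> has a sign. Its uses below are
  guarded accordingly.\<close>

definition seed_mutation :: "'n \<Rightarrow> 'n::finite seed \<Rightarrow> 'n seed" where
  "seed_mutation k = (\<lambda>(c, B).
     (\<lambda>i. if i = k then - c k else c i + pos_part (vec_sgn (c k) * B $ k $ i) *s c k,
      matrix_mutation k B))"

definition initial_seed :: "int ^ 'n ^ 'n \<Rightarrow> 'n::finite seed" where
  "initial_seed B0 = (\<lambda>i. axis i 1, B0)"

inductive Y_seed_wrt :: "int ^ 'n ^ 'n \<Rightarrow> 'n::finite seed \<Rightarrow> bool" for B0 where
  initial: "Y_seed_wrt B0 (initial_seed B0)"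
| mutate: "Y_seed_wrt B0 (c, B) \<Longrightarrow> 0 < c k \<or> c k < 0 \<Longrightarrow>
    Y_seed_wrt B0 (seed_mutation k (c, B))"

definition sign_coherent :: "int ^ 'n::finite ^ 'n \<Rightarrow> bool" where
  "sign_coherent B0 \<longleftrightarrow>
    (\<forall>c B. Y_seed_wrt B0 (c, B) \<longrightarrow>
       (\<forall>j. (\<forall>i. 0 \<le> c j $ i) \<or> (\<forall>i. c j $ i \<le> 0)))"

text \<open>Well-defined whenever \<open>c\<close> is a basis; see \<open>Y_seed_wrt_coords_unique\<close> below.\<close>

definition coords :: "('n::finite \<Rightarrow> int ^ 'n) \<Rightarrow> real ^ 'n \<Rightarrow> 'n \<Rightarrow> real" where
  "coords c u = (THE a. u = (\<Sum>i\<in>UNIV. a i *\<^sub>R real_vec (c i)))"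

definition mutate_along :: "int ^ 'n ^ 'n \<Rightarrow> 'n list \<Rightarrow> 'n::finite seed" where
  "mutate_along B0 ks = fold seed_mutation ks (initial_seed B0)"

definition green_sequence :: "int ^ 'n::finite ^ 'n \<Rightarrow> 'n list \<Rightarrow> bool" where
  "green_sequence B0 ks \<longleftrightarrow>
    (\<forall>m < length ks. 0 < fst (mutate_along B0 (take m ks)) (ks ! m))"

definition maximal_green_sequence :: "int ^ 'n::finite ^ 'n \<Rightarrow> 'n list \<Rightarrow> bool" where
  "maximal_green_sequence B0 ks \<longleftrightarrow>
    green_sequence B0 ks \<and> (\<forall>k. fst (mutate_along B0 ks) k < 0)"


lemma skew_symmetrizable_iff:
  "skew_symmetrizable B \<longleftrightarrow>
    (\<exists>d. (\<forall>i. 0 < d i) \<and>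
      (\<forall>i j. d i * real_of_int (B $ i $ j) = - (d j * real_of_int (B $ j $ i))))"
proof -
  have prod: "(D ** real_mat B) $ i $ j = D $ i $ i * real_of_int (B $ i $ j)"
    if "\<forall>i j. i \<noteq> j \<longrightarrow> D $ i $ j = 0" for D :: "real ^ 'a ^ 'a" and i j
  proof -
    have "(D ** real_mat B) $ i $ j = (\<Sum>l\<in>UNIV. D $ i $ l * real_of_int (B $ l $ j))"
      by (simp add: matrix_matrix_mult_def real_mat_def)
    also have "\<dots> = (\<Sum>l\<in>UNIV. if l = i then D $ i $ i * real_of_int (B $ i $ j) else 0)"
      using that by (intro sum.cong) auto
    finally show ?thesis by simp
  qed
  show ?thesis
  proof
    assume "skew_symmetrizable B"
    then obtain D :: "real ^ 'a ^ 'a" where D: "\<forall>i j. i \<noteq> j \<longrightarrow> D $ i $ j = 0"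
      "\<forall>i. 0 < D $ i $ i" and skew: "transpose (D ** real_mat B) = - (D ** real_mat B)"
      unfolding skew_symmetrizable_def by blast
    have "D $ i $ i * real_of_int (B $ i $ j) = - (D $ j $ j * real_of_int (B $ j $ i))" for i j
    proof -
      have "transpose (D ** real_mat B) $ j $ i = - (D ** real_mat B) $ j $ i"
        by (simp add: skew)
      then show ?thesis by (simp add: transpose_def prod[OF D(1)])
    qed
    then show "\<exists>d. (\<forall>i. 0 < d i) \<and>
      (\<forall>i j. d i * real_of_int (B $ i $ j) = - (d j * real_of_int (B $ j $ i)))"
      using D(2) by (intro exI[of _ "\<lambda>i. D $ i $ i"] conjI allI) blast+
  next
    assume "\<exists>d. (\<forall>i. 0 < d i) \<and>
      (\<forall>i j. d i * real_of_int (B $ i $ j) = - (d j * real_of_int (B $ j $ i)))"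
    then obtain d where d: "\<forall>i. 0 < d i"
      "\<And>i j. d i * real_of_int (B $ i $ j) = - (d j * real_of_int (B $ j $ i))" by blast
    define D :: "real ^ 'a ^ 'a" where "D = (\<chi> i j. if i = j then d i else 0)"
    have D: "\<forall>i j. i \<noteq> j \<longrightarrow> D $ i $ j = 0" "\<forall>i. D $ i $ i = d i"
      by (auto simp: D_def)
    have "transpose (D ** real_mat B) = - (D ** real_mat B)"
      unfolding vec_eq_iff
    proof (intro allI)
      show "transpose (D ** real_mat B) $ i $ j = (- (D ** real_mat B)) $ i $ j" for i j
        using d(2)[of j i] by (simp add: transpose_def prod[OF D(1)] D(2))
    qed
    then show "skew_symmetrizable B"
      unfolding skew_symmetrizable_def using D d(1) by (intro exI[of _ D]) auto
  qed
qed

lemma skew_symmetrizable_mutation: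
  assumes "skew_symmetrizable B"
  shows "skew_symmetrizable (matrix_mutation k B)"
proof -
  from assms obtain d where d: "\<And>i. 0 < d i"
    "\<And>i j. d i * real_of_int (B $ i $ j) = - (d j * real_of_int (B $ j $ i))"
    unfolding skew_symmetrizable_iff by blast
  have pp: "d i * real_of_int (pos_part (B $ i $ j)) = d j * real_of_int (pos_part (- B $ j $ i))"
    for i j
  proof -
    have "d i * max (real_of_int (B $ i $ j)) 0 = max (d i * real_of_int (B $ i $ j)) 0"
      using d(1)[of i] by (simp add: max_mult_distrib_left)
    also have "\<dots> = max (d j * - real_of_int (B $ j $ i)) 0"
      by (simp add: d(2)[of i j])
    also have "\<dots> = d j * max (- real_of_int (B $ j $ i)) 0"
      using d(1)[of j] by (simp add: max_mult_distrib_left)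
    finally show ?thesis by (simp add: pos_part_def of_int_max)
  qed
  have tw: "d i * (real_of_int (pos_part (B $ i $ k)) * real_of_int (pos_part (B $ k $ j))) =
     d j * (real_of_int (pos_part (- B $ j $ k)) * real_of_int (pos_part (- B $ k $ i)))" for i j
  proof -
    have "d i * (real_of_int (pos_part (B $ i $ k)) * real_of_int (pos_part (B $ k $ j))) =
       (d i * real_of_int (pos_part (B $ i $ k))) * real_of_int (pos_part (B $ k $ j))" by simp
    also have "\<dots> = (d k * real_of_int (pos_part (B $ k $ j))) * real_of_int (pos_part (- B $ k $ i))"
      by (simp add: pp[of i k])
    finally show ?thesis by (simp add: pp[of k j])
  qed
  show ?thesis unfolding skew_symmetrizable_iff
  proof (intro exI[of _ d] conjI allI)
    show "0 < d i" for i by (rule d)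
    show "d i * real_of_int (matrix_mutation k B $ i $ j) =
      - (d j * real_of_int (matrix_mutation k B $ j $ i))" for i j
      using d(2)[of i j] tw[of i j] tw[of j i]
      by (auto simp: matrix_mutation_def algebra_simps)
  qed
qed

lemma combination_mutation:
  fixes c :: "'n::finite \<Rightarrow> int ^ 'n" and a :: "'n \<Rightarrow> real" and k :: 'n and B :: "int ^ 'n ^ 'n"
  defines "p \<equiv> \<lambda>i. pos_part (vec_sgn (c k) * B $ k $ i)"
  shows "(\<Sum>i\<in>UNIV. a i *\<^sub>R real_vec (fst (seed_mutation k (c, B)) i)) =
    (\<Sum>i\<in>UNIV. (a(k := (\<Sum>i\<in>-{k}. a i * real_of_int (p i)) - a k)) i *\<^sub>R real_vec (c i))"
proof -
  let ?c' = "fst (seed_mutation k (c, B))"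
  let ?s = "\<Sum>i\<in>-{k}. a i * real_of_int (p i)"
  have split: "(\<Sum>i\<in>UNIV. f i) = f k + (\<Sum>i\<in>-{k}. f i)" for f :: "'n \<Rightarrow> real ^ 'n"
    unfolding Compl_eq_Diff_UNIV by (rule sum.remove) simp_all
  have k: "real_vec (?c' k) = - real_vec (c k)"
    by (simp add: seed_mutation_def real_vec_def vec_eq_iff)
  have o: "real_vec (?c' i) = real_vec (c i) + real_of_int (p i) *\<^sub>R real_vec (c k)"
    if "i \<in> -{k}" for i
    using that by (simp add: seed_mutation_def real_vec_def vec_eq_iff p_def)
  have "(\<Sum>i\<in>UNIV. a i *\<^sub>R real_vec (?c' i)) =
      a k *\<^sub>R real_vec (?c' k) + (\<Sum>i\<in>-{k}. a i *\<^sub>R real_vec (?c' i))"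
    by (rule split)
  also have "(\<Sum>i\<in>-{k}. a i *\<^sub>R real_vec (?c' i)) =
      (\<Sum>i\<in>-{k}. a i *\<^sub>R real_vec (c i) + (a i * real_of_int (p i)) *\<^sub>R real_vec (c k))"
    by (rule sum.cong[OF refl]) (simp only: o scaleR_add_right scaleR_scaleR)
  also have "\<dots> = (\<Sum>i\<in>-{k}. a i *\<^sub>R real_vec (c i)) + ?s *\<^sub>R real_vec (c k)"
    by (simp only: sum.distrib scaleR_sum_left)
  also have "(\<Sum>i\<in>-{k}. a i *\<^sub>R real_vec (c i)) =
      (\<Sum>i\<in>-{k}. (a(k := ?s - a k)) i *\<^sub>R real_vec (c i))"
    by (rule sum.cong) auto
  also have "a k *\<^sub>R real_vec (?c' k) +
      ((\<Sum>i\<in>-{k}. (a(k := ?s - a k)) i *\<^sub>R real_vec (c i)) + ?s *\<^sub>R real_vec (c k)) =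
      (a(k := ?s - a k)) k *\<^sub>R real_vec (c k) +
      (\<Sum>i\<in>-{k}. (a(k := ?s - a k)) i *\<^sub>R real_vec (c i))"
    unfolding k fun_upd_same by (simp only: scaleR_left_diff_distrib scaleR_minus_right) simp
  also have "\<dots> = (\<Sum>i\<in>UNIV. (a(k := ?s - a k)) i *\<^sub>R real_vec (c i))"
    by (rule split[symmetric])
  finally show ?thesis .
qed

lemma Y_seed_wrt_coords_unique:
  assumes "Y_seed_wrt B0 (c, B)"
  shows "\<exists>!a. u = (\<Sum>i\<in>UNIV. a i *\<^sub>R real_vec (c i))"
proof -
  have "\<exists>!a. u = (\<Sum>i\<in>UNIV. a i *\<^sub>R real_vec (fst S i))" if "Y_seed_wrt B0 S" for S
    using that
  proof induction
    case initial
    have "(\<Sum>i\<in>UNIV. a i *\<^sub>R real_vec (axis i 1)) = (\<chi> i. a i)" for a :: "'a \<Rightarrow> real"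
    proof -
      have "(\<Sum>i\<in>UNIV. a i * (real_vec (axis i 1) $ j)) = a j" for j
      proof -
        have "(\<Sum>i\<in>UNIV. a i * (real_vec (axis i 1) $ j)) = (\<Sum>i\<in>UNIV. if i = j then a j else 0)"
          by (rule sum.cong) (auto simp: real_vec_def axis_def)
        then show ?thesis by simp
      qed
      then show ?thesis by (simp add: vec_eq_iff)
    qed
    then show ?case
      by (intro ex1I[of _ "\<lambda>i. u $ i"]) (auto simp: initial_seed_def vec_eq_iff)
  next
    case (mutate c B k)
    define p where "p = (\<lambda>i. pos_part (vec_sgn (c k) * B $ k $ i))"
    define phi where "phi = (\<lambda>a :: 'a \<Rightarrow> real. a(k := (\<Sum>i\<in>-{k}. a i * real_of_int (p i)) - a k))"
    have inv: "phi (phi a) = a" for a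
    proof -
      have "(\<Sum>i\<in>-{k}. phi a i * real_of_int (p i)) = (\<Sum>i\<in>-{k}. a i * real_of_int (p i))"
        by (rule sum.cong) (auto simp: phi_def)
      then show ?thesis by (auto simp: fun_eq_iff phi_def)
    qed
    have eq: "(\<Sum>i\<in>UNIV. a i *\<^sub>R real_vec (fst (seed_mutation k (c, B)) i)) =
      (\<Sum>i\<in>UNIV. phi a i *\<^sub>R real_vec (c i))" for a
      unfolding phi_def p_def by (rule combination_mutation)
    from mutate.IH obtain b where b: "u = (\<Sum>i\<in>UNIV. b i *\<^sub>R real_vec (c i))"
      and uniq: "\<And>a. u = (\<Sum>i\<in>UNIV. a i *\<^sub>R real_vec (c i)) \<Longrightarrow> a = b"
      by (auto elim!: ex1E)
    show ?case
    proof (rule ex1I[of _ "phi b"])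
      show "u = (\<Sum>i\<in>UNIV. phi b i *\<^sub>R real_vec (fst (seed_mutation k (c, B)) i))"
        unfolding eq inv by (rule b)
      show "a = phi b" if "u = (\<Sum>i\<in>UNIV. a i *\<^sub>R real_vec (fst (seed_mutation k (c, B)) i))" for a
        using uniq[of "phi a"] that unfolding eq by (metis inv)
    qed
  qed
  from this[OF assms] show ?thesis by simp
qed

lemma Y_seed_wrt_nonzero:
  assumes "Y_seed_wrt B0 (c, B)"
  shows "c j \<noteq> 0"
proof
  assume "c j = 0"
  then have z: "real_vec (c j) = 0" by (simp add: real_vec_def vec_eq_iff)
  let ?e = "\<lambda>i. if i = j then 1 else 0 :: real"
  obtain b where b: "\<And>a. 0 = (\<Sum>i\<in>UNIV. a i *\<^sub>R real_vec (c i)) \<Longrightarrow> a = b"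
    using Y_seed_wrt_coords_unique[OF assms, of 0] by (elim ex1E) blast
  have "?e = b"
    by (intro b sum.neutral[symmetric] ballI) (simp add: z)
  moreover have "(\<lambda>i. 0) = b"
    by (rule b) simp
  ultimately have "?e = (\<lambda>i. 0)" by (rule trans[OF _ sym])
  from fun_cong[OF this, of j] show False by simp
qed

lemma Y_seed_wrt_imp_Y_seed:
  assumes "skew_symmetrizable B0" "Y_seed_wrt B0 S"
  shows "Y_seed S"
proof -
  from assms(2) have "skew_symmetrizable (snd S)"
    by induction
      (auto simp: assms(1) initial_seed_def seed_mutation_def intro: skew_symmetrizable_mutation)
  with assms(2) show ?thesis
    by (cases S) (auto simp: Y_seed_def dest: Y_seed_wrt_nonzero)
qed

lemma green_sequence_Y_seed_wrt:
  assumes "green_sequence B0 ks"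
  shows "Y_seed_wrt B0 (mutate_along B0 ks)"
  using assms
proof (induction ks rule: rev_induct)
  case Nil
  show ?case by (simp add: mutate_along_def initial)
next
  case (snoc k ks)
  have "green_sequence B0 ks"
    unfolding green_sequence_def
  proof (intro allI impI)
    fix m assume "m < length ks"
    with snoc.prems[unfolded green_sequence_def, rule_format, of m]
    show "0 < fst (mutate_along B0 (take m ks)) (ks ! m)"
      by (simp add: nth_append)
  qed
  then have "Y_seed_wrt B0 (mutate_along B0 ks)" by (rule snoc.IH)
  moreover have "0 < fst (mutate_along B0 ks) k"
    using snoc.prems[unfolded green_sequence_def, rule_format, of "length ks"] by simp
  ultimately show ?case
    using mutate[of B0 "fst (mutate_along B0 ks)" "snd (mutate_along B0 ks)" k]
    by (simp add: mutate_along_def)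
qed

end

theory Submission
  imports Defs
begin

text \<open>A maximal green sequence would end in a \<open>Y\<close>-seed all of whose vectors
  \<open>c i\<close> are negative. There \<open>u\<close> is a combination of the \<open>c i\<close>
  with non-negative coefficients, so every entry of \<open>u\<close> is non-positive, contradicting
  \<open>0 < u\<close>. The expansion of \<open>u\<close> is \<open>coords_sum\<close>; that the
  final seed is reachable is \<open>green_sequence_Y_seed_wrt\<close>.\<close>

lemma coords_sum:
  assumes "Y_seed_wrt B0 (c, B)"
  shows "u = (\<Sum>i\<in>UNIV. coords c u i *\<^sub>R real_vec (c i))"
  unfolding coords_def by (rule theI'[OF Y_seed_wrt_coords_unique[OF assms]])

theorem proposition1:
  fixes B0 :: "int ^ 'n ^ 'n"
  assumes "skew_symmetrizable B0"
    and "sign_coherent B0"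
    and "\<exists>u :: real ^ 'n. 0 < u \<and>
           (\<forall>c B. Y_seed_wrt B0 (c, B) \<longrightarrow> (\<forall>i. 0 \<le> coords c u i))"
  shows "\<not> (\<exists>ks. maximal_green_sequence B0 ks)"
proof
  assume "\<exists>ks. maximal_green_sequence B0 ks"
  then obtain ks where green: "green_sequence B0 ks"
    and neg: "\<And>k. fst (mutate_along B0 ks) k < 0"
    unfolding maximal_green_sequence_def by blast
  obtain c B where cB: "mutate_along B0 ks = (c, B)"
    by (cases "mutate_along B0 ks")
  \<comment> \<open>Each mutation in a green sequence is at a positive vector, hence defined, so the
    hypothesis on \<open>u\<close> applies to the final seed.\<close>
  from green_sequence_Y_seed_wrt[OF green] have seed: "Y_seed_wrt B0 (c, B)"
    unfolding cB .
  from assms(3) seed obtain u :: "real ^ 'n" where u: "0 < u"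
    and nonneg: "\<And>i. 0 \<le> coords c u i"
    by blast
  have "c i \<le> 0" for i
    using neg[of i] by (simp add: cB less_imp_le)
  then have entry: "real_vec (c i) $ j \<le> 0" for i j
    by (simp add: real_vec_def less_eq_vec_def)
  have "u $ j \<le> 0" for j
  proof -
    have "u $ j = (\<Sum>i\<in>UNIV. coords c u i * real_vec (c i) $ j)"
      by (subst coords_sum[OF seed, of u]) simp
    also have "\<dots> \<le> 0"
      by (intro sum_nonpos mult_nonneg_nonpos nonneg entry)
    finally show ?thesis .
  qed
  then have "u \<le> 0"
    by (simp add: less_eq_vec_def)
  \<comment> \<open>In the componentwise order \<open>0 < u\<close> includes
    \<open>u \<noteq> 0\<close>, so it is incompatible with \<open>u \<le> 0\<close>.\<close>
  with u show False
    by simp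
qed

end
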